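(* Let $M$ be a monoid with monoid presentation $\langle X_M : R_M\rangle$ via a surjective morphism $\phi_M:X_M^*\to M$, and write $\overline x=x\phi_M$ for $x\in X_M$. Let $n\ge2$ and $\mathbf n=\{1,\ldots,n\}$. Let $X$ be the alphabet $$X=\{e_1,\ldots,e_n\}\cup\{x^{(i;j)}:x\in X_M,\ i,j\in\mathbf n,\ i\ne j\}$$ (all listed letters being distinct). For a word $w=x_1\cdots x_k\in X_M^*$ and distinct $i,j\in\mathbf n$, let $w^{(i;j)}=x_1^{(i;j)}\cdots x_k^{(i;j)}$ if $k\ge1$, and $w^{(i;j)}=e_j$ if $k=0$. Let $R$ be the following set of relations over $X$, where $x,y\in X_M$ and $i,j,k\in\mathbf n$ range over all values for which the letters are defined, subject to stated constraints: (1) $e_i^2=e_i$; (2) $e_ie_j=e_je_i$; (3) $u^{(i;j)}=v^{(i;j)}$ for $(u,v)\in R_M$; (4) $x^{(i;j)}e_k=e_kx^{(i;j)}=e_jx^{(i;k)}$ if $k\ne i,j$; (5) $x^{(i;j)}e_j=e_jx^{(i;j)}=x^{(i;j)}$; (6) $x^{(i;j)}e_i=e_ix^{(i;j)}=e_ie_j$; (7) $x^{(i;k)}y^{(j;k)}=y^{(j;k)}x^{(i;k)}$ if $i\ne j$. Let $\phi:X^+\to M_0^n\setminus M^n$ be the semigroup morphism sending $e_i$ to the tuple with $0$ in position $i$ and $1$ in all other positions, and sending $x^{(i;j)}$ to the tuple with $\overline x$ in position $i$, $0$ in position $j$, and $1$ in all other positions. Then the semigroup $M_0^n\setminus M^n$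 has semigroup presentation $\langle X:R\rangle$ via $\phi$.
   Context: $M_0=M\cup\{0\}$ is the monoid obtained from $M$ (with identity $1$) by adjoining a new symbol $0$ as a zero element (even if $M$ already has a zero). $M_0^n$ is the direct power with componentwise multiplication, and $M_0^n\setminus M^n$ (denoted $\mathrm{Sing}(M_0^n)$ in the paper) is its subsemigroup of all $n$-tuples over $M_0$ with at least one entry equal to $0$. Presentations: a monoid $N$ has monoid presentation $\langle Y:S\rangle$ via $\psi$ if $\psi:Y^*\to N$ is a surjective monoid morphism from the free monoid $Y^*$ whose kernel $\{(u,v):u\psi=v\psi\}$ is the congruence on $Y^*$ generated by $S$. A semigroup $T$ has semigroup presentation $\langle X:R\rangle$, where $R\subseteq X^+\times X^+$, via $\phi$ if $\phi:X^+\to T$ is a surjective semigroup morphism from the free semigroup $X^+$ (non-empty words) whose kernel is the congruence on $X^+$ generated by $R$. A relation $(u,v)$ is written $u=v$. *)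

theory Defs
  imports "HOL-Algebra.Product_Groups"
begin

section \<open>Congruences and presentations\<close>

text \<open>
  Semigroups are represented by monoid records of which only the carrier and the multiplication
  are used; the \<open>one\<close> field is ignored and need not lie in the carrier.
\<close>

definition is_semigroup :: "('a, 'b) monoid_scheme \<Rightarrow> bool" where
  "is_semigroup G \<longleftrightarrow>
     (\<forall>x\<in>carrier G. \<forall>y\<in>carrier G. x \<otimes>\<^bsub>G\<^esub> y \<in> carrier G) \<and>
     (\<forall>x\<in>carrier G. \<forall>y\<in>carrier G. \<forall>z\<in>carrier G.
        (x \<otimes>\<^bsub>G\<^esub> y) \<otimes>\<^bsub>G\<^esub> z = x \<otimes>\<^bsub>G\<^esub> (y \<otimes>\<^bsub>G\<^esub> z))"

definition is_congruence :: "('a, 'b) monoid_scheme \<Rightarrow> ('a \<times> 'a) set \<Rightarrow> bool" where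
  "is_congruence G c \<longleftrightarrow> equiv (carrier G) c \<and>
     (\<forall>(u, v)\<in>c. \<forall>w\<in>carrier G.
        (w \<otimes>\<^bsub>G\<^esub> u, w \<otimes>\<^bsub>G\<^esub> v) \<in> c \<and> (u \<otimes>\<^bsub>G\<^esub> w, v \<otimes>\<^bsub>G\<^esub> w) \<in> c)"

definition generated_congruence ::
  "('a, 'b) monoid_scheme \<Rightarrow> ('a \<times> 'a) set \<Rightarrow> ('a \<times> 'a) set" where
  "generated_congruence G S = \<Inter>{c. is_congruence G c \<and> S \<subseteq> c}"

definition kernel_pairs :: "('a, 'b) monoid_scheme \<Rightarrow> ('a \<Rightarrow> 'c) \<Rightarrow> ('a \<times> 'a) set" where
  "kernel_pairs G f = {(u, v). u \<in> carrier G \<and> v \<in> carrier G \<and> f u = f v}"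

definition free_monoid :: "'a set \<Rightarrow> 'a list monoid" where
  "free_monoid Y = \<lparr>carrier = lists Y, monoid.mult = (@), one = []\<rparr>"

definition free_semigroup :: "'a set \<Rightarrow> 'a list monoid" where
  "free_semigroup X = (free_monoid X)\<lparr>carrier := lists X - {[]}\<rparr>"

definition monoid_presentation ::
  "('a, 'b) monoid_scheme \<Rightarrow> 'x set \<Rightarrow> ('x list \<times> 'x list) set \<Rightarrow> ('x list \<Rightarrow> 'a) \<Rightarrow> bool" where
  "monoid_presentation N Y S \<psi> \<longleftrightarrow>
     monoid N \<and>
     S \<subseteq> carrier (free_monoid Y) \<times> carrier (free_monoid Y) \<and>
     \<psi> \<in> hom (free_monoid Y) N \<and> \<psi> \<one>\<^bsub>free_monoid Y\<^esub> = \<one>\<^bsub>N\<^esub> \<and>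
     \<psi> ` carrier (free_monoid Y) = carrier N \<and>
     kernel_pairs (free_monoid Y) \<psi> = generated_congruence (free_monoid Y) S"

definition semigroup_presentation ::
  "('a, 'b) monoid_scheme \<Rightarrow> 'x set \<Rightarrow> ('x list \<times> 'x list) set \<Rightarrow> ('x list \<Rightarrow> 'a) \<Rightarrow> bool" where
  "semigroup_presentation T X R \<phi> \<longleftrightarrow>
     is_semigroup T \<and>
     R \<subseteq> carrier (free_semigroup X) \<times> carrier (free_semigroup X) \<and>
     \<phi> \<in> hom (free_semigroup X) T \<and>
     \<phi> ` carrier (free_semigroup X) = carrier T \<and>
     kernel_pairs (free_semigroup X) \<phi> = generated_congruence (free_semigroup X) R"


section \<open>The singular part of a direct power of a monoid with zero adjoined\<close>

text \<open>The adjoined zero is \<open>None\<close>; it is new even if the monoid already has a zero.\<close>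

definition adjoin_zero :: "('a, 'b) monoid_scheme \<Rightarrow> 'a option monoid" where
  "adjoin_zero M =
     \<lparr>carrier = insert None (Some ` carrier M),
      monoid.mult = (\<lambda>a b. case (a, b) of (Some x, Some y) \<Rightarrow> Some (x \<otimes>\<^bsub>M\<^esub> y) | _ \<Rightarrow> None),
      one = Some \<one>\<^bsub>M\<^esub>\<rparr>"

text \<open>\<^const>\<open>product_group\<close> is the direct product of arbitrary monoid records.\<close>

definition zero_power :: "nat \<Rightarrow> ('a, 'b) monoid_scheme \<Rightarrow> (nat \<Rightarrow> 'a option) monoid" where
  "zero_power n M = product_group {1..n} (\<lambda>_. adjoin_zero M)"

definition Sing :: "nat \<Rightarrow> ('a, 'b) monoid_scheme \<Rightarrow> (nat \<Rightarrow> 'a option) monoid" where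
  "Sing n M = (zero_power n M)
     \<lparr>carrier := carrier (zero_power n M) - (\<Pi>\<^sub>E i\<in>{1..n}. Some ` carrier M)\<rparr>"


section \<open>The alphabet, the relations and the morphism\<close>

text \<open>\<open>E i\<close> stands for $e_i$ and \<open>L x i j\<close> for $x^{(i;j)}$.\<close>

datatype 'x letter = E nat | L 'x nat nat

definition alphabet :: "nat \<Rightarrow> 'x set \<Rightarrow> 'x letter set" where
  "alphabet n X\<^sub>M = E ` {1..n} \<union> {L x i j | x i j. x \<in> X\<^sub>M \<and> i \<in> {1..n} \<and> j \<in> {1..n} \<and> i \<noteq> j}"

definition lift_word :: "nat \<Rightarrow> nat \<Rightarrow> 'x list \<Rightarrow> 'x letter list" where
  "lift_word i j w = (if w = [] then [E j] else map (\<lambda>x. L x i j) w)"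

text \<open>A chain of equations $a = b = c$ contributes the two pairs $(a, b)$ and $(b, c)$.\<close>

definition relations ::
  "nat \<Rightarrow> 'x set \<Rightarrow> ('x list \<times> 'x list) set \<Rightarrow> ('x letter list \<times> 'x letter list) set" where
  "relations n X\<^sub>M R\<^sub>M =
     {([E i, E i], [E i]) | i. i \<in> {1..n}} \<union>
     {([E i, E j], [E j, E i]) | i j. i \<in> {1..n} \<and> j \<in> {1..n}} \<union>
     {(lift_word i j u, lift_word i j v) | i j u v.
        (u, v) \<in> R\<^sub>M \<and> i \<in> {1..n} \<and> j \<in> {1..n} \<and> i \<noteq> j} \<union>
     {([L x i j, E k], [E k, L x i j]) | x i j k.
        x \<in> X\<^sub>M \<and> i \<in> {1..n} \<and> j \<in> {1..n} \<and> k \<in> {1..n} \<and> i \<noteq> j \<and> k \<noteq> i \<and> k \<noteq> j} \<union>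
     {([E k, L x i j], [E j, L x i k]) | x i j k.
        x \<in> X\<^sub>M \<and> i \<in> {1..n} \<and> j \<in> {1..n} \<and> k \<in> {1..n} \<and> i \<noteq> j \<and> k \<noteq> i \<and> k \<noteq> j} \<union>
     {([L x i j, E j], [E j, L x i j]) | x i j.
        x \<in> X\<^sub>M \<and> i \<in> {1..n} \<and> j \<in> {1..n} \<and> i \<noteq> j} \<union>
     {([E j, L x i j], [L x i j]) | x i j.
        x \<in> X\<^sub>M \<and> i \<in> {1..n} \<and> j \<in> {1..n} \<and> i \<noteq> j} \<union>
     {([L x i j, E i], [E i, L x i j]) | x i j.
        x \<in> X\<^sub>M \<and> i \<in> {1..n} \<and> j \<in> {1..n} \<and> i \<noteq> j} \<union>
     {([E i, L x i j], [E i, E j]) | x i j.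
        x \<in> X\<^sub>M \<and> i \<in> {1..n} \<and> j \<in> {1..n} \<and> i \<noteq> j} \<union>
     {([L x i k, L y j k], [L y j k, L x i k]) | x y i j k.
        x \<in> X\<^sub>M \<and> y \<in> X\<^sub>M \<and> i \<in> {1..n} \<and> j \<in> {1..n} \<and> k \<in> {1..n} \<and>
        i \<noteq> k \<and> j \<noteq> k \<and> i \<noteq> j}"

fun letter_image ::
  "nat \<Rightarrow> ('a, 'b) monoid_scheme \<Rightarrow> ('x list \<Rightarrow> 'a) \<Rightarrow> 'x letter \<Rightarrow> (nat \<Rightarrow> 'a option)" where
  "letter_image n M \<phi>\<^sub>M (E i) = (\<lambda>k\<in>{1..n}. if k = i then None else Some \<one>\<^bsub>M\<^esub>)"
| "letter_image n M \<phi>\<^sub>M (L x i j) =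
     (\<lambda>k\<in>{1..n}. if k = i then Some (\<phi>\<^sub>M [x]) else if k = j then None else Some \<one>\<^bsub>M\<^esub>)"

text \<open>
  The product, in the full direct power, of the images of the letters of a word. The value at
  the empty word is the identity of the power, which is irrelevant for the free semigroup.
\<close>

definition word_image ::
  "nat \<Rightarrow> ('a, 'b) monoid_scheme \<Rightarrow> ('x list \<Rightarrow> 'a) \<Rightarrow> 'x letter list \<Rightarrow> (nat \<Rightarrow> 'a option)" where
  "word_image n M \<phi>\<^sub>M w =
     foldr (\<lambda>a t. letter_image n M \<phi>\<^sub>M a \<otimes>\<^bsub>zero_power n M\<^esub> t) w \<one>\<^bsub>zero_power n M\<^esub>"

end

theory Submission
  imports Defs
begin

text \<open>
  Two invariants of a word \<open>u\<close> decide its image. The set \<open>zeros u\<close> collects the positions at which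
  some letter of \<open>u\<close> contributes a $0$, and \<open>content i u\<close> is the word over $X_M$ formed by the
  letters \<open>x\<close> of those \<open>L x i j\<close> that occur in \<open>u\<close>, whatever their \<open>j\<close>. The image is $0$ at the
  positions in \<open>zeros u\<close> and the value of \<open>content i u\<close> at every other position \<open>i\<close>
  (\<open>word_image_eq\<close>). The defining relations preserve the zeros and, outside them, the values of the
  contents, which gives one inclusion between the generated congruence and the kernel.

  For the other inclusion these data have to determine \<open>u\<close> up to the relations. Fix \<open>j \<in> zeros u\<close>. The
  letters \<open>E k\<close> are central, and multiplying by \<open>E k\<close> does not change a word that already has a zero
  at \<open>k\<close> (\<open>zero_absorb\<close>); so \<open>E j\<close> may be inserted anywhere in \<open>u\<close>. In its presence the relation
  $e_j x^{(i;k)} = e_k x^{(i;j)}$ turns every second index into \<open>j\<close>, apart from letters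
  $x^{(j;k)}$, which become $e_k$ because of $e_j x^{(j;k)} = e_j e_k$. After that, letters with
  different first indices commute, a letter \<open>L x i j\<close> next to \<open>E i\<close> becomes \<open>E j\<close>, and sorting by
  first index brings \<open>u\<close> to a product of one factor for each coordinate: \<open>E i\<close> if \<open>i\<close> is a zero of
  \<open>u\<close>, and otherwise $w^{(i;j)}$ where \<open>w = content i u\<close> (\<open>word_normal_form\<close>).

  Two words with the same image have the same zeros, hence normal forms with the same \<open>j\<close>, and
  at the other coordinates contents with the same value in $M$. Modulo the relations,
  $w \mapsto w^{(i;j)}$ is a morphism with $e_j$ as image of the empty word, so equality of values in
  $M$ carries over to the factors (\<open>lift_word_cong\<close>) and the two normal forms are congruent.
  The normal forms also show surjectivity, since zeros and contents can be prescribed.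
\<close>

section \<open>The congruence generated by a set of relations, without membership conditions\<close>

text \<open>
  The relation ranges over all lists, so derivations need no check that words are non-empty or
  spelled in the right alphabet. Nothing is added to the congruence on the free semigroup: a pair of
  relators from $X^+$ can only be applied inside words of $X^+$ to yield words of $X^+$, and this is
  what \<open>cong_closure_in_congruence\<close> states.
\<close>

inductive cong_closure :: "('a list \<times> 'a list) set \<Rightarrow> 'a list \<Rightarrow> 'a list \<Rightarrow> bool" for R where
  base: "(u, v) \<in> R \<Longrightarrow> cong_closure R u v"
| refl: "cong_closure R u u"
| sym: "cong_closure R u v \<Longrightarrow> cong_closure R v u"
| trans: "cong_closure R u v \<Longrightarrow> cong_closure R v w \<Longrightarrow> cong_closure R u w"
| append: "cong_closure R u u' \<Longrightarrow> cong_closure R v v' \<Longrightarrow> cong_closure R (u @ v) (u' @ v')"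

lemma cong_closure_in_congruence:
  assumes "cong_closure R u v"
    and R: "R \<subseteq> carrier (free_semigroup X) \<times> carrier (free_semigroup X)"
    and c: "is_congruence (free_semigroup X) c" "R \<subseteq> c"
  shows "(u \<in> lists X \<longleftrightarrow> v \<in> lists X) \<and> (u = [] \<longleftrightarrow> v = []) \<and>
    (u \<in> lists X \<longrightarrow> u \<noteq> [] \<longrightarrow> (u, v) \<in> c)"
  using assms(1)
proof induction
  case (base u v)
  then show ?case using R c by (auto simp: free_semigroup_def)
next
  case (refl u)
  have "refl_on (lists X - {[]}) c"
    using c(1) by (auto simp: is_congruence_def equiv_def free_semigroup_def)
  then show ?case by (auto simp: refl_on_def)
next
  case (sym u v)
  have "sym_on UNIV c"
    using c(1) by (auto simp: is_congruence_def equiv_def)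
  with sym show ?case by (blast dest: symD)
next
  case (trans u v w)
  have "Relation.trans c"
    using c(1) by (auto simp: is_congruence_def equiv_def)
  with trans show ?case by (blast dest: transD)
next
  case (append u u' v v')
  have tr: "Relation.trans c"
    using c(1) by (auto simp: is_congruence_def equiv_def)
  have l: "(w @ a, w @ b) \<in> c" and r: "(a @ w, b @ w) \<in> c"
    if "(a, b) \<in> c" "w \<in> lists X" "w \<noteq> []" for a b w
    using c(1) that unfolding is_congruence_def
    by (auto simp: free_semigroup_def free_monoid_def)
  \<comment> \<open>Empty words must be split off: \<open>c\<close> is only known to be compatible with non-empty ones.\<close>
  have "(u @ v, u' @ v') \<in> c"
    if "u @ v \<in> lists X" "u @ v \<noteq> []"
  proof (cases "u = [] \<or> v = []")
    case True
    then show ?thesis using append.IH that by auto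
  next
    case False
    with append.IH that have "(u @ v, u' @ v) \<in> c" "(u' @ v, u' @ v') \<in> c"
      by (auto intro!: l r)
    then show ?thesis using tr by (blast dest: transD)
  qed
  with append.IH show ?case by auto
qed

section \<open>Zero positions and coordinate words\<close>

fun zero_position :: "'x letter \<Rightarrow> nat" where
  "zero_position (E j) = j"
| "zero_position (L x i j) = j"

definition zeros :: "'x letter list \<Rightarrow> nat set" where
  "zeros u = zero_position ` set u"

fun letter_content :: "nat \<Rightarrow> 'x letter \<Rightarrow> 'x list" where
  "letter_content i (E j) = []"
| "letter_content i (L x k j) = (if k = i then [x] else [])"

definition content :: "nat \<Rightarrow> 'x letter list \<Rightarrow> 'x list" where
  "content i u = concat (map (letter_content i) u)"

lemma zeros_simps [simp]:
  "zeros [] = {}" "zeros (a # u) = insert (zero_position a) (zeros u)"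
  "zeros (u @ v) = zeros u \<union> zeros v"
  by (auto simp: zeros_def)

lemma content_simps [simp]:
  "content i [] = []" "content i (a # u) = letter_content i a @ content i u"
  "content i (u @ v) = content i u @ content i v"
  by (simp_all add: content_def)

lemma zeros_concat: "zeros (concat us) = (\<Union>u\<in>set us. zeros u)"
  by (induction us) auto

lemma zeros_lift_word [simp]: "zeros (lift_word i j w) = {j}"
  by (cases w) (auto simp: lift_word_def zeros_def)

lemma content_lift_word [simp]: "content k (lift_word i j w) = (if k = i then w else [])"
proof -
  have "content k (map (\<lambda>x. L x i j) w) = (if k = i then w else [])" by (induction w) auto
  then show ?thesis by (auto simp: lift_word_def)
qed

lemma alphabet_simps [simp]:
  "E i \<in> alphabet n X \<longleftrightarrow> i \<in> {1..n}"
  "L x i j \<in> alphabet n X \<longleftrightarrow> x \<in> X \<and> i \<in> {1..n} \<and> j \<in> {1..n} \<and> i \<noteq> j"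
  unfolding alphabet_def by blast+

lemma zero_position_range: "a \<in> alphabet n X \<Longrightarrow> zero_position a \<in> {1..n}"
  by (cases a) simp_all

lemma zeros_subset: "u \<in> lists (alphabet n X) \<Longrightarrow> zeros u \<subseteq> {1..n}"
  using zero_position_range by (fastforce simp: zeros_def)

lemma zeros_eq_empty [simp]: "zeros u = {} \<longleftrightarrow> u = []"
  by (simp add: zeros_def)

lemma letter_content_in_lists:
  "a \<in> alphabet n X \<Longrightarrow> letter_content i a \<in> lists X"
  by (cases a) auto

lemma content_in_lists:
  "u \<in> lists (alphabet n X) \<Longrightarrow> content i u \<in> lists X"
proof (induction u)
  case (Cons a u)
  then show ?case using letter_content_in_lists[of a n X i] by simp
qed simp

lemma lift_word_in_lists:
  "w \<in> lists X \<Longrightarrow> i \<in> {1..n} \<Longrightarrow> j \<in> {1..n} \<Longrightarrow> i \<noteq> j \<Longrightarrow> lift_word i j w \<in> lists (alphabet n X)"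
  by (auto simp: lift_word_def)

text \<open>
  The \<open>i\<close>-th factor of the normal form with zero set \<open>Z\<close> and coordinate words \<open>w\<close>; its letters have
  their zeros at \<open>i\<close> if \<open>i \<in> Z\<close>, and at the reference position \<open>j \<in> Z\<close> otherwise. Giving each coordinate
  exactly one factor, zeros included, lets all manipulations be done factor by factor.
\<close>

definition factor :: "nat \<Rightarrow> nat set \<Rightarrow> (nat \<Rightarrow> 'x list) \<Rightarrow> nat \<Rightarrow> 'x letter list" where
  "factor j Z w i = (if i \<in> Z then [E i] else lift_word i j (w i))"

definition normal_form :: "nat \<Rightarrow> nat \<Rightarrow> nat set \<Rightarrow> (nat \<Rightarrow> 'x list) \<Rightarrow> 'x letter list" where
  "normal_form n j Z w = concat (map (factor j Z w) [1..<Suc n])"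

text \<open>
  The coordinate words at positions in \<open>Z\<close> are overwritten by zeros and carry no information.
\<close>

lemma normal_form_cong:
  assumes "\<And>i. i \<in> {1..n} - Z \<Longrightarrow> w i = w' i"
  shows "normal_form n j Z w = normal_form n j Z w'"
proof -
  have "map (factor j Z w) [1..<Suc n] = map (factor j Z w') [1..<Suc n]"
    using assms by (intro map_cong refl) (auto simp: factor_def)
  then show ?thesis by (simp only: normal_form_def)
qed

lemma factor_in_lists:
  "\<lbrakk>j \<in> {1..n}; j \<in> Z; i \<in> {1..n}; i \<notin> Z \<Longrightarrow> w i \<in> lists X\<rbrakk>
    \<Longrightarrow> factor j Z w i \<in> lists (alphabet n X)"
  by (cases "i \<in> Z") (auto simp: factor_def lift_word_def)

lemma normal_form_in_lists:
  assumes "j \<in> {1..n}" "j \<in> Z" "\<And>i. i \<in> {1..n} - Z \<Longrightarrow> w i \<in> lists X"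
  shows "normal_form n j Z w \<in> lists (alphabet n X)"
proof -
  have "factor j Z w i \<in> lists (alphabet n X)" if "i \<in> {1..n}" for i
    using assms that by (intro factor_in_lists) auto
  moreover have "set [1..<Suc n] = {1..n}" by auto
  ultimately have "\<forall>us \<in> set (map (factor j Z w) [1..<Suc n]). us \<in> lists (alphabet n X)"
    unfolding set_map by blast
  then show ?thesis unfolding normal_form_def in_lists_conv_set set_concat by blast
qed

lemma zeros_normal_form:
  assumes "j \<in> Z" "Z \<subseteq> {1..n}"
  shows "zeros (normal_form n j Z w) = Z"
proof -
  have "zeros (normal_form n j Z w) = (\<Union>i\<in>{1..n}. zeros (factor j Z w i))"
    unfolding normal_form_def zeros_concat set_map image_image set_upt atLeastLessThanSuc_atLeastAtMost
    by blast
  also have "\<dots> = Z" using assms by (auto simp: factor_def split: if_splits)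
  finally show ?thesis .
qed

lemma content_normal_form:
  assumes "i \<in> {1..n}" "i \<notin> Z"
  shows "content i (normal_form n j Z w) = w i"
proof -
  have other: "content i (concat (map (factor j Z w) xs)) = []" if "i \<notin> set xs" for xs
    using that by (induction xs) (auto simp: factor_def)
  have split: "[1..<Suc n] = [1..<i] @ i # [Suc i..<Suc n]"
    using assms(1) upt_add_eq_append[of 1 i "Suc n - i"] upt_conv_Cons[of i "Suc n"] by auto
  have "content i (factor j Z w i) = w i" using assms(2) by (simp add: factor_def)
  then show ?thesis unfolding normal_form_def split using other by (simp del: upt_Suc)
qed

section \<open>Reduction to normal form\<close>

locale singular_relations =
  fixes n :: nat and X :: "'x set" and R :: "('x list \<times> 'x list) set"
begin

abbreviation rel :: "'x letter list \<Rightarrow> 'x letter list \<Rightarrow> bool" (infix "\<simeq>" 50) where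
  "u \<simeq> v \<equiv> cong_closure (relations n X R) u v"

lemmas rel_trans [trans] = cong_closure.trans

lemma rel_context: "u \<simeq> v \<Longrightarrow> p @ u @ q \<simeq> p @ v @ q"
  by (intro cong_closure.append cong_closure.refl)

lemma rel_prefix: "u \<simeq> v \<Longrightarrow> p @ u \<simeq> p @ v"
  by (intro cong_closure.append cong_closure.refl)

lemma rel_suffix: "u \<simeq> v \<Longrightarrow> u @ q \<simeq> v @ q"
  by (intro cong_closure.append cong_closure.refl)

lemma rel_Cons: "u \<simeq> v \<Longrightarrow> a # u \<simeq> a # v"
  using rel_prefix[of u v "[a]"] by simp

lemma E_idem: "i \<in> {1..n} \<Longrightarrow> [E i, E i] \<simeq> [E i]"
  by (rule cong_closure.base) (auto simp: relations_def)

lemma E_commute: "i \<in> {1..n} \<Longrightarrow> j \<in> {1..n} \<Longrightarrow> [E i, E j] \<simeq> [E j, E i]"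
  by (rule cong_closure.base) (auto simp: relations_def)

context
  fixes x i j
  assumes x: "x \<in> X" and i: "i \<in> {1..n}" and j: "j \<in> {1..n}" and ij: "i \<noteq> j"
begin

lemma E_L_commute:
  assumes "k \<in> {1..n}" shows "[E k, L x i j] \<simeq> [L x i j, E k]"
proof -
  have "([L x i j, E k], [E k, L x i j]) \<in> relations n X R"
    using x i j ij assms unfolding relations_def by (cases "k = i"; cases "k = j") auto
  then show ?thesis by (intro cong_closure.sym[OF cong_closure.base])
qed

lemma E_L_swap: "k \<in> {1..n} \<Longrightarrow> k \<noteq> i \<Longrightarrow> k \<noteq> j \<Longrightarrow> [E k, L x i j] \<simeq> [E j, L x i k]"
  using x i j ij by (intro cong_closure.base) (auto simp: relations_def)

lemma E_L_absorb: "[E j, L x i j] \<simeq> [L x i j]"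
  using x i j ij by (intro cong_closure.base) (auto simp: relations_def)

lemma E_L_kill: "[E i, L x i j] \<simeq> [E i, E j]"
  using x i j ij by (intro cong_closure.base) (auto simp: relations_def)

lemma L_commute: "y \<in> X \<Longrightarrow> k \<in> {1..n} \<Longrightarrow> k \<noteq> i \<Longrightarrow> k \<noteq> j \<Longrightarrow> [L x i j, L y k j] \<simeq> [L y k j, L x i j]"
  using x i j ij by (intro cong_closure.base) (auto simp: relations_def)

end

text \<open>
  Commutation of \<open>E k\<close> with another \<open>E i\<close> is one relation; with \<open>L x i j\<close> it is spread over three of
  them, according to whether \<open>k\<close> is \<open>i\<close>, \<open>j\<close> or neither.
\<close>

lemma E_central:
  assumes k: "k \<in> {1..n}" and "u \<in> lists (alphabet n X)"
  shows "E k # u \<simeq> u @ [E k]"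
  using assms(2)
proof induction
  case Nil
  show ?case by (simp add: cong_closure.refl)
next
  case (Cons a u)
  have "[E k, a] \<simeq> [a, E k]"
    using k Cons.hyps(1) by (cases a) (auto intro: E_commute E_L_commute)
  from rel_suffix[OF this, of u] have "E k # a # u \<simeq> a # E k # u" by simp
  also have "\<dots> \<simeq> a # u @ [E k]" using Cons.IH by (rule rel_Cons)
  finally show ?case by simp
qed

text \<open>
  Some letter of \<open>u\<close> has its zero at \<open>k\<close> and absorbs \<open>E k\<close> by idempotency or by
  $e_k x^{(i;k)} = x^{(i;k)}$; centrality carries \<open>E k\<close> to that letter.
\<close>

lemma zero_absorb:
  assumes "u \<in> lists (alphabet n X)" "k \<in> zeros u"
  shows "E k # u \<simeq> u"
  using assms
proof induction
  case Nil
  then show ?case by simp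
next
  case (Cons a u)
  then have k: "k \<in> {1..n}" using zeros_subset[of "a # u" n X] by auto
  show ?case
  proof (cases "k = zero_position a")
    case True
    have "[E k, a] \<simeq> [a]"
      using k Cons.hyps(1) True by (cases a) (auto intro: E_idem E_L_absorb)
    from rel_suffix[OF this, of u] show ?thesis by simp
  next
    case False
    have "[E k, a] \<simeq> [a, E k]"
      using E_central[OF k, of "[a]"] Cons.hyps(1) by simp
    from rel_suffix[OF this, of u] have "E k # a # u \<simeq> a # E k # u" by simp
    also have "\<dots> \<simeq> a # u" using Cons False by (intro rel_Cons) auto
    finally show ?thesis .
  qed
qed

text \<open>
  The only case that is not an identity of lists is an empty \<open>u\<close> or \<open>v\<close>, which contributes an
  extra \<open>E j\<close>; it is absorbed because every lifted word has a zero at \<open>j\<close>.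
\<close>

lemma lift_word_append:
  assumes "i \<in> {1..n}" "j \<in> {1..n}" "i \<noteq> j" "u \<in> lists X" "v \<in> lists X"
  shows "lift_word i j (u @ v) \<simeq> lift_word i j u @ lift_word i j v"
proof -
  have v: "E j # lift_word i j v \<simeq> lift_word i j v"
    using assms by (intro zero_absorb lift_word_in_lists) auto
  have "E j # lift_word i j u \<simeq> lift_word i j u"
    using assms by (intro zero_absorb lift_word_in_lists) auto
  moreover have "E j # lift_word i j u \<simeq> lift_word i j u @ [E j]"
    using assms by (intro E_central lift_word_in_lists) auto
  ultimately have u: "lift_word i j u \<simeq> lift_word i j u @ [E j]"
    by (meson cong_closure.sym cong_closure.trans)
  consider "u = []" | "v = []" | "u \<noteq> []" "v \<noteq> []" by blast
  then show ?thesis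
  proof cases
    case 1
    then show ?thesis using cong_closure.sym[OF v] by (simp add: lift_word_def)
  next
    case 2
    then show ?thesis using u by (simp add: lift_word_def)
  next
    case 3
    then show ?thesis by (simp add: lift_word_def cong_closure.refl)
  qed
qed

lemma lift_word_kill:
  assumes ij: "i \<in> {1..n}" "j \<in> {1..n}" "i \<noteq> j" and "w \<in> lists X"
  shows "E i # E j # lift_word i j w \<simeq> [E i, E j]"
  using assms(4)
proof (induction w)
  case Nil
  show ?case using rel_Cons[OF E_idem] ij by (simp add: lift_word_def)
next
  case (Cons x w)
  have "E i # E j # lift_word i j ([x] @ w) \<simeq> E i # E j # lift_word i j [x] @ lift_word i j w"
    using Cons.hyps ij by (intro rel_Cons lift_word_append) auto
  also have "\<dots> = E i # ([E j, L x i j]) @ lift_word i j w" by (simp add: lift_word_def)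
  also have "\<dots> \<simeq> E i # [L x i j] @ lift_word i j w"
    using Cons.hyps ij by (intro rel_Cons rel_suffix E_L_absorb) auto
  also have "\<dots> = [E i, L x i j] @ lift_word i j w" by simp
  also have "\<dots> \<simeq> [E i, E j] @ lift_word i j w"
    using Cons.hyps ij by (intro rel_suffix E_L_kill) auto
  also have "\<dots> \<simeq> [E i, E j]" using Cons.IH by simp
  finally show ?case by simp
qed

lemma L_lift_word_commute:
  assumes "x \<in> X" "i \<in> {1..n}" "j \<in> {1..n}" "k \<in> {1..n}" "i \<noteq> j" "k \<noteq> j" "k \<noteq> i"
    and "w \<in> lists X"
  shows "L x i j # lift_word k j w \<simeq> lift_word k j w @ [L x i j]"
proof (cases "w = []")
  case True
  then show ?thesis
    using cong_closure.sym[OF E_L_commute[of x i j j]] assms by (simp add: lift_word_def)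
next
  case False
  have "L x i j # map (\<lambda>x. L x k j) w \<simeq> map (\<lambda>x. L x k j) w @ [L x i j]"
    using assms(8)
  proof (induction w)
    case Nil
    show ?case by (simp add: cong_closure.refl)
  next
    case (Cons y w)
    have "[L x i j, L y k j] @ map (\<lambda>x. L x k j) w \<simeq> [L y k j, L x i j] @ map (\<lambda>x. L x k j) w"
      using assms Cons.hyps by (intro rel_suffix L_commute) auto
    also have "\<dots> \<simeq> L y k j # map (\<lambda>x. L x k j) w @ [L x i j]"
      using rel_Cons[OF Cons.IH] by simp
    finally show ?case by simp
  qed
  then show ?thesis using False by (simp add: lift_word_def)
qed

text \<open>
  The pairs of words whose lifts are related form a congruence, because lifting is a morphism
  modulo the relations; the lifts of the pairs in \<open>R\<close> are defining relations.
\<close>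

lemma lift_word_cong:
  assumes ij: "i \<in> {1..n}" "j \<in> {1..n}" "i \<noteq> j"
    and R: "R \<subseteq> lists X \<times> lists X"
    and uv: "(u, v) \<in> generated_congruence (free_monoid X) R"
  shows "lift_word i j u \<simeq> lift_word i j v"
proof -
  define c where "c = {(u, v). u \<in> lists X \<and> v \<in> lists X \<and> lift_word i j u \<simeq> lift_word i j v}"
  have app: "(u @ u', v @ v') \<in> c" if "(u, v) \<in> c" "(u', v') \<in> c" for u u' v v'
  proof -
    have "lift_word i j (u @ u') \<simeq> lift_word i j u @ lift_word i j u'"
      using that by (intro lift_word_append ij) (auto simp: c_def)
    also have "\<dots> \<simeq> lift_word i j v @ lift_word i j v'"
      using that by (intro cong_closure.append) (auto simp: c_def)
    also have "\<dots> \<simeq> lift_word i j (v @ v')"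
      using that by (intro cong_closure.sym[OF lift_word_append] ij) (auto simp: c_def)
    finally show ?thesis using that by (auto simp: c_def)
  qed
  have refl: "(w, w) \<in> c" if "w \<in> lists X" for w
    using that by (simp add: c_def cong_closure.refl)
  have equiv: "equiv (lists X) c"
    by (rule equivI)
      (auto simp: c_def refl_on_def sym_def trans_def
        intro: cong_closure.refl cong_closure.sym cong_closure.trans)
  have closed: "(w @ u, w @ v) \<in> c \<and> (u @ w, v @ w) \<in> c"
    if "(u, v) \<in> c" "w \<in> lists X" for u v w
    by (intro conjI app refl that)
  have "is_congruence (free_monoid X) c"
    unfolding is_congruence_def free_monoid_def monoid.simps partial_object.simps
  proof (intro conjI ballI)
    fix p assume "p \<in> c"
    then obtain u v where "p = (u, v)" "(u, v) \<in> c" by (cases p) auto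
    then show "case p of (u, v) \<Rightarrow> \<forall>w\<in>lists X. (w @ u, w @ v) \<in> c \<and> (u @ w, v @ w) \<in> c"
      using closed[of u v] by simp
  qed (rule equiv)
  moreover have "R \<subseteq> c"
  proof clarify
    fix u v assume uv: "(u, v) \<in> R"
    then have "(lift_word i j u, lift_word i j v) \<in> {(lift_word i j u, lift_word i j v) | i j u v.
        (u, v) \<in> R \<and> i \<in> {1..n} \<and> j \<in> {1..n} \<and> i \<noteq> j}"
      using ij by blast
    then have "(lift_word i j u, lift_word i j v) \<in> relations n X R"
      unfolding relations_def by (simp only: Un_iff simp_thms)
    with uv R show "(u, v) \<in> c" by (auto simp: c_def intro: cong_closure.base)
  qed
  ultimately have "(u, v) \<in> c" using uv by (auto simp: generated_congruence_def)
  then show ?thesis by (simp add: c_def)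
qed

lemma concat_map_cong:
  assumes "\<And>i. i \<in> set xs \<Longrightarrow> F i \<simeq> G i"
  shows "concat (map F xs) \<simeq> concat (map G xs)"
  using assms by (induction xs) (auto intro: cong_closure.refl cong_closure.append)

text \<open>
  A central idempotent prefix can be duplicated and moved next to each factor in turn, so factors
  may be exchanged as soon as they agree in its presence.
\<close>

lemma concat_map_cong_idem:
  assumes idem: "p @ p \<simeq> p" and central: "\<And>u. u \<in> lists (alphabet n X) \<Longrightarrow> p @ u \<simeq> u @ p"
    and "\<And>i. i \<in> set xs \<Longrightarrow>
      F i \<in> lists (alphabet n X) \<and> G i \<in> lists (alphabet n X) \<and> p @ F i \<simeq> p @ G i"
  shows "p @ concat (map F xs) \<simeq> p @ concat (map G xs)"
  using assms(3)
proof (induction xs)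
  case Nil
  show ?case by (simp add: cong_closure.refl)
next
  case (Cons i xs)
  have double: "p @ a @ c \<simeq> (p @ a) @ p @ c" if "a \<in> lists (alphabet n X)" for a c
  proof -
    have "p @ a @ c \<simeq> p @ (p @ a) @ c" using rel_suffix[OF cong_closure.sym[OF idem]] by simp
    also have "\<dots> \<simeq> p @ (a @ p) @ c" by (intro rel_context central that)
    finally show ?thesis by simp
  qed
  have "p @ F i @ concat (map F xs) \<simeq> (p @ F i) @ p @ concat (map F xs)"
    using Cons.prems by (intro double) auto
  also have "\<dots> \<simeq> (p @ G i) @ p @ concat (map G xs)"
    using Cons by (intro cong_closure.append[of _ "p @ F i" "p @ G i"]) auto
  also have "\<dots> \<simeq> p @ G i @ concat (map G xs)"
    using Cons.prems by (intro cong_closure.sym[OF double]) auto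
  finally show ?case by simp
qed

lemma Cons_concat_map:
  assumes "distinct xs" "i \<in> set xs"
    and "\<And>k. k \<in> set xs \<Longrightarrow> k \<noteq> i \<Longrightarrow> a # F k \<simeq> F k @ [a]"
  shows "a # concat (map F xs) \<simeq> concat (map (F(i := a # F i)) xs)"
  using assms
proof (induction xs)
  case Nil
  then show ?case by simp
next
  case (Cons k xs)
  show ?case
  proof (cases "k = i")
    case True
    then have "map (F(i := a # F i)) xs = map F xs" using Cons.prems by auto
    then have "concat (map (F(i := a # F i)) (k # xs)) = a # concat (map F (k # xs))"
      using True by (simp del: map_eq_conv)
    then show ?thesis by (metis cong_closure.refl)
  next
    case False
    have "(a # F k) @ concat (map F xs) \<simeq> (F k @ [a]) @ concat (map F xs)"
      using False Cons.prems by (intro rel_suffix) auto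
    also have "\<dots> = F k @ a # concat (map F xs)" by simp
    also have "\<dots> \<simeq> F k @ concat (map (F(i := a # F i)) xs)"
      using False Cons by (intro rel_prefix Cons.IH) auto
    finally show ?thesis using False by (simp del: fun_upd_apply add: fun_upd_other)
  qed
qed

text \<open>
  Multiplying a normal form by one letter on the left gives a normal form again. The statements
  below treat letters \<open>E k\<close>, letters \<open>L x i j\<close> with the reference position \<open>j\<close> as second index,
  and then arbitrary letters, which reduce to these two cases.
\<close>

context
  fixes j :: nat and Z :: "nat set" and w :: "nat \<Rightarrow> 'x list"
  assumes j: "j \<in> Z" and Z: "Z \<subseteq> {1..n}"
    and w: "\<And>i. i \<in> {1..n} \<Longrightarrow> w i \<in> lists X"
begin

lemma j_range: "j \<in> {1..n}"
  using j Z by blast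

lemma normal_form_absorb:
  assumes "k \<in> Z" shows "E k # normal_form n j Z w \<simeq> normal_form n j Z w"
  using assms j Z w j_range
  by (intro zero_absorb normal_form_in_lists) (auto simp: zeros_normal_form)

lemma insert_zero_normal_form_absorb:
  assumes "k \<in> {1..n}" "m \<in> insert k Z"
  shows "E m # normal_form n j (insert k Z) w \<simeq> normal_form n j (insert k Z) w"
proof -
  have "zeros (normal_form n j (insert k Z) w) = insert k Z"
    using assms j Z by (intro zeros_normal_form) auto
  moreover have "normal_form n j (insert k Z) w \<in> lists (alphabet n X)"
    using j w j_range by (intro normal_form_in_lists) auto
  ultimately show ?thesis using assms by (intro zero_absorb) auto
qed

text \<open>
  The new zero at \<open>k\<close> has to erase the word at coordinate \<open>k\<close>. In the presence of \<open>E k\<close> each letter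
  \<open>L x k j\<close> turns into \<open>E j\<close>, so the two normal forms agree factor by factor after the prefix
  \<open>[E k, E j]\<close>. That prefix is then absorbed, both \<open>k\<close> and \<open>j\<close> being zeros of the result.
\<close>

lemma E_normal_form:
  assumes k: "k \<in> {1..n}"
  shows "E k # normal_form n j Z w \<simeq> normal_form n j (insert k Z) w"
proof -
  let ?p = "[E k, E j]"
  have p_lists: "?p \<in> lists (alphabet n X)" using k j_range by simp
  have central: "?p @ u \<simeq> u @ ?p" if u: "u \<in> lists (alphabet n X)" for u
  proof -
    have "?p @ u \<simeq> E k # u @ [E j]" using rel_Cons[OF E_central[OF j_range u]] by simp
    also have "\<dots> \<simeq> (u @ [E k]) @ [E j]" using rel_suffix[OF E_central[OF k u], of "[E j]"] by simp
    finally show ?thesis by simp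
  qed
  have idem: "?p @ ?p \<simeq> ?p"
  proof -
    have "E j # ?p \<simeq> ?p" using p_lists by (intro zero_absorb) auto
    from rel_Cons[OF this, of "E k"] have "?p @ ?p \<simeq> E k # ?p" by simp
    also have "\<dots> \<simeq> ?p" using p_lists by (intro zero_absorb) auto
    finally show ?thesis .
  qed
  have kill: "?p @ factor j Z w i \<simeq> ?p @ factor j (insert k Z) w i" if i: "i \<in> {1..n}" for i
  proof (cases "i = k \<and> k \<notin> Z")
    case True
    then have "k \<noteq> j" using j by blast
    have "?p @ lift_word k j (w k) \<simeq> ?p"
      using lift_word_kill[OF k j_range \<open>k \<noteq> j\<close> w[OF k]] by simp
    also have "?p \<simeq> ?p @ [E k]"
    proof -
      have "?p \<simeq> E k # ?p" using p_lists by (intro cong_closure.sym[OF zero_absorb]) auto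
      also have "\<dots> \<simeq> ?p @ [E k]" by (intro E_central k p_lists)
      finally show ?thesis .
    qed
    finally show ?thesis using True by (simp add: factor_def)
  next
    case False
    then have "factor j Z w i = factor j (insert k Z) w i" by (auto simp: factor_def)
    then show ?thesis by (simp add: cong_closure.refl)
  qed
  have "E k # normal_form n j Z w \<simeq> ?p @ normal_form n j Z w"
    using rel_Cons[OF cong_closure.sym[OF normal_form_absorb[OF j]]] by simp
  also have "\<dots> \<simeq> ?p @ normal_form n j (insert k Z) w"
    unfolding normal_form_def
  proof (rule concat_map_cong_idem[OF idem central])
    fix i assume "i \<in> set [1..<Suc n]"
    then have i: "i \<in> {1..n}" by auto
    show "factor j Z w i \<in> lists (alphabet n X) \<and>
        factor j (insert k Z) w i \<in> lists (alphabet n X) \<and>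
        ?p @ factor j Z w i \<simeq> ?p @ factor j (insert k Z) w i"
      using j_range j i w kill by (intro conjI factor_in_lists) auto
  qed
  also have "\<dots> \<simeq> E k # normal_form n j (insert k Z) w"
    using rel_Cons[OF insert_zero_normal_form_absorb[OF k, of j]] j by simp
  also have "\<dots> \<simeq> normal_form n j (insert k Z) w"
    by (intro insert_zero_normal_form_absorb k) auto
  finally show ?thesis .
qed

text \<open>
  If \<open>i\<close> is a zero, the letter meets \<open>E i\<close> and is erased; otherwise it commutes past the factors
  before the \<open>i\<close>-th and is prepended to that one.
\<close>

lemma L_normal_form_same:
  assumes x: "x \<in> X" and i: "i \<in> {1..n}" and ij: "i \<noteq> j"
  shows "L x i j # normal_form n j Z w \<simeq> normal_form n j Z (w(i := x # w i))"
proof (cases "i \<in> Z")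
  case True
  note lij = x i j_range ij
  have "L x i j # normal_form n j Z w \<simeq> [L x i j, E i] @ normal_form n j Z w"
    using rel_Cons[OF cong_closure.sym[OF normal_form_absorb[OF True]]] by simp
  also have "\<dots> \<simeq> [E i, L x i j] @ normal_form n j Z w"
    by (intro rel_suffix cong_closure.sym[OF E_L_commute] lij)
  also have "\<dots> \<simeq> [E i, E j] @ normal_form n j Z w"
    by (intro rel_suffix E_L_kill lij)
  also have "\<dots> \<simeq> E i # normal_form n j Z w"
    using rel_Cons[OF normal_form_absorb[OF j]] by simp
  also have "\<dots> \<simeq> normal_form n j Z w" by (rule normal_form_absorb[OF True])
  finally have "L x i j # normal_form n j Z w \<simeq> normal_form n j Z w" .
  moreover have "normal_form n j Z w = normal_form n j Z (w(i := x # w i))"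
    using True by (intro normal_form_cong) auto
  ultimately show ?thesis by metis
next
  case False
  let ?F = "factor j Z w"
  have "L x i j # normal_form n j Z w \<simeq> concat (map (?F(i := L x i j # ?F i)) [1..<Suc n])"
    unfolding normal_form_def
  proof (rule Cons_concat_map)
    fix k assume "k \<in> set [1..<Suc n]" and ki: "k \<noteq> i"
    then have k: "k \<in> {1..n}" by auto
    show "L x i j # ?F k \<simeq> ?F k @ [L x i j]"
    proof (cases "k \<in> Z")
      case True
      have "[L x i j, E k] \<simeq> [E k, L x i j]"
        by (intro cong_closure.sym[OF E_L_commute] x i j_range ij k)
      then show ?thesis using True by (simp add: factor_def)
    next
      case False
      then have "k \<noteq> j" using j by blast
      then show ?thesis
        using L_lift_word_commute[OF x i j_range k ij _ ki w[OF k]] False by (simp add: factor_def)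
    qed
  qed (use i in auto)
  also have "\<dots> \<simeq> normal_form n j Z (w(i := x # w i))"
    unfolding normal_form_def
  proof (rule concat_map_cong)
    fix k
    have "L x i j # lift_word i j (w i) \<simeq> lift_word i j (x # w i)"
      using cong_closure.sym[OF lift_word_append[OF i j_range ij, of "[x]" "w i"]] x w[OF i]
      by (simp add: lift_word_def[of i j "[x]"])
    then show "(?F(i := L x i j # ?F i)) k \<simeq> factor j Z (w(i := x # w i)) k"
      using False by (auto simp: factor_def cong_closure.refl)
  qed
  finally show ?thesis .
qed

end

lemma letter_normal_form:
  assumes j: "j \<in> Z" and Z: "Z \<subseteq> {1..n}"
    and w: "\<And>i. i \<in> {1..n} \<Longrightarrow> w i \<in> lists X"
    and a: "a \<in> alphabet n X"
  shows "a # normal_form n j Z w \<simeq>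
    normal_form n j (insert (zero_position a) Z) (\<lambda>i. letter_content i a @ w i)"
proof (cases a)
  case (E k)
  then show ?thesis using E_normal_form[OF j Z w] a by simp
next
  case (L x i k)
  note E = E_normal_form[OF j Z w]
  let ?N = "normal_form n j"
  have xik: "x \<in> X" "i \<in> {1..n}" "k \<in> {1..n}" "i \<noteq> k" using a L by auto
  have jr: "j \<in> {1..n}" using j Z by blast
  define w' where "w' = w(i := x # w i)"
  have w': "w' m \<in> lists X" if "m \<in> {1..n}" for m using that w xik by (auto simp: w'_def)
  have content: "(\<lambda>m. letter_content m a @ w m) = w'" using L by (auto simp: w'_def)
  have swap: "[L x i k, E j] \<simeq> [E j, L x i k]"
    by (intro cong_closure.sym[OF E_L_commute] xik jr)
  have "L x i k # ?N Z w \<simeq> ?N (insert k Z) w'"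
  proof (cases "k = j")
    case True
    then show ?thesis
      using L_normal_form_same[OF j Z w xik(1,2)] xik j by (simp add: w'_def insert_absorb)
  next
    case False
    have "L x i k # ?N Z w \<simeq> [L x i k, E j] @ ?N Z w"
      using rel_Cons[OF cong_closure.sym[OF normal_form_absorb[OF j Z w j]]] by simp
    also have "\<dots> \<simeq> [E j, L x i k] @ ?N Z w"
      by (intro rel_suffix swap)
    finally have *: "L x i k # ?N Z w \<simeq> [E j, L x i k] @ ?N Z w" .
    \<comment> \<open>Borrowing \<open>E j\<close> from the normal form makes the index \<open>k\<close> replaceable by \<open>j\<close>. This fails only
      for \<open>i = j\<close>, where \<open>L x j j\<close> does not exist and the letter is erased instead.\<close>
    show ?thesis
    proof (cases "i = j")
      case True
      note *
      also have "[E j, L x i k] @ ?N Z w \<simeq> [E j, E k] @ ?N Z w"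
        using E_L_kill[OF xik] True by (intro rel_suffix) simp
      also have "\<dots> \<simeq> E j # ?N (insert k Z) w"
        using rel_Cons[OF E[OF _ xik(3)]] w by simp
      also have "\<dots> \<simeq> ?N (insert k Z) w"
        using j by (intro insert_zero_normal_form_absorb Z w xik) auto
      also have "\<dots> = ?N (insert k Z) w'"
        using True j by (intro normal_form_cong) (auto simp: w'_def)
      finally show ?thesis .
    next
      case False
      note *
      also have "[E j, L x i k] @ ?N Z w \<simeq> [E k, L x i j] @ ?N Z w"
        using False \<open>k \<noteq> j\<close> by (intro rel_suffix E_L_swap xik jr) auto
      also have "\<dots> \<simeq> E k # ?N Z w'"
        using rel_Cons[OF L_normal_form_same[OF j Z w xik(1,2) False]] by (simp add: w'_def)
      also have "\<dots> \<simeq> ?N (insert k Z) w'" by (rule E_normal_form[OF j Z w' xik(3)])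
      finally show ?thesis .
    qed
  qed
  then show ?thesis using L content by simp
qed

lemma normal_form_start:
  assumes j: "j \<in> {1..n}"
  shows "[E j] \<simeq> normal_form n j {j} (\<lambda>_. [])"
proof -
  have "[E j] \<simeq> concat (map (factor j {j} (\<lambda>_. [])) xs)" if "xs \<noteq> []" for xs
    using that
  proof (induction xs rule: list_nonempty_induct)
    case (single k)
    show ?case by (simp add: factor_def lift_word_def cong_closure.refl)
  next
    case (cons k xs)
    have "[E j] \<simeq> [E j, E j]" by (intro cong_closure.sym[OF E_idem] j)
    also have "\<dots> \<simeq> E j # concat (map (factor j {j} (\<lambda>_. [])) xs)"
      using cons.IH by (rule rel_Cons)
    finally show ?case by (simp add: factor_def[of _ _ _ k] lift_word_def[of k])
  qed
  then show ?thesis using j by (auto simp: normal_form_def simp del: upt_Suc)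
qed

text \<open>
  The extra \<open>E j\<close> provides a starting normal form, the one with zero set \<open>{j}\<close>, to which the letters
  of \<open>u\<close> are then added from right to left. The position \<open>j\<close> thus stays fixed throughout the
  induction, although suffixes of \<open>u\<close> may have no zero there.
\<close>

lemma append_E_normal_form:
  assumes u: "u \<in> lists (alphabet n X)" and j: "j \<in> {1..n}"
  shows "u @ [E j] \<simeq> normal_form n j (insert j (zeros u)) (\<lambda>i. content i u)"
  using u
proof induction
  case Nil
  show ?case using normal_form_start[OF j] by simp
next
  case (Cons a u)
  have "a # u @ [E j] \<simeq> a # normal_form n j (insert j (zeros u)) (\<lambda>i. content i u)"
    using Cons.IH by (rule rel_Cons)
  also have "\<dots> \<simeq> normal_form n j (insert (zero_position a) (insert j (zeros u)))
      (\<lambda>i. letter_content i a @ content i u)"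
    using Cons.hyps j zeros_subset[of u n X] content_in_lists[of u n X]
    by (intro letter_normal_form) blast+
  finally show ?case by (simp add: insert_commute)
qed

lemma word_normal_form:
  assumes u: "u \<in> lists (alphabet n X)" and j: "j \<in> zeros u"
  shows "u \<simeq> normal_form n j (zeros u) (\<lambda>i. content i u)"
proof -
  have jr: "j \<in> {1..n}" using zeros_subset[OF u] j by blast
  have "u \<simeq> E j # u" by (intro cong_closure.sym[OF zero_absorb] u j)
  also have "\<dots> \<simeq> u @ [E j]" by (intro E_central jr u)
  also have "\<dots> \<simeq> normal_form n j (zeros u) (\<lambda>i. content i u)"
    using append_E_normal_form[OF u jr] j by (simp add: insert_absorb)
  finally show ?thesis .
qed

text \<open>
  Completeness: zeros and contents modulo \<open>R\<close> determine a word modulo the relations. A common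
  reference position \<open>j\<close> exists because a non-empty word has a zero.
\<close>

lemma words_related:
  assumes R: "R \<subseteq> lists X \<times> lists X"
    and u: "u \<in> lists (alphabet n X)" "u \<noteq> []" and v: "v \<in> lists (alphabet n X)"
    and zeros: "zeros u = zeros v"
    and content: "\<And>i. i \<in> {1..n} - zeros u \<Longrightarrow>
      (content i u, content i v) \<in> generated_congruence (free_monoid X) R"
  shows "u \<simeq> v"
proof -
  obtain j where j: "j \<in> zeros u" using u(2) zeros_eq_empty by blast
  have "u \<simeq> normal_form n j (zeros u) (\<lambda>i. content i u)"
    by (rule word_normal_form[OF u(1) j])
  also have "\<dots> \<simeq> normal_form n j (zeros u) (\<lambda>i. content i v)"
    unfolding normal_form_def
  proof (rule concat_map_cong)
    fix i assume "i \<in> set [1..<Suc n]"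
    then have i: "i \<in> {1..n}" by auto
    have "lift_word i j (content i u) \<simeq> lift_word i j (content i v)" if "i \<notin> zeros u"
      using i j that zeros_subset[OF u(1)] by (intro lift_word_cong R content) auto
    then show "factor j (zeros u) (\<lambda>i. content i u) i \<simeq> factor j (zeros u) (\<lambda>i. content i v) i"
      by (simp add: factor_def cong_closure.refl)
  qed
  also have "\<dots> \<simeq> v"
    using cong_closure.sym[OF word_normal_form[OF v]] j zeros by simp
  finally show ?thesis .
qed

end

section \<open>Evaluation in the direct power\<close>

lemma monoid_presentation_hom:
  assumes "monoid_presentation M X R \<phi>"
  shows "\<phi> [] = \<one>\<^bsub>M\<^esub>"
    and "u \<in> lists X \<Longrightarrow> \<phi> u \<in> carrier M"
    and "u \<in> lists X \<Longrightarrow> v \<in> lists X \<Longrightarrow> \<phi> (u @ v) = \<phi> u \<otimes>\<^bsub>M\<^esub> \<phi> v"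
  using assms by (auto simp: monoid_presentation_def free_monoid_def hom_def)

lemma word_image_eq:
  assumes P: "monoid_presentation M X R \<phi>" and u: "u \<in> lists (alphabet n X)"
  shows "word_image n M \<phi> u =
    (\<lambda>i\<in>{1..n}. if i \<in> zeros u then None else Some (\<phi> (content i u)))"
  using u
proof induction
  case Nil
  show ?case
    by (auto simp: word_image_def zero_power_def product_group_def adjoin_zero_def
        monoid_presentation_hom(1)[OF P])
next
  case (Cons a u)
  have letter: "letter_image n M \<phi> a =
      (\<lambda>i\<in>{1..n}. if i = zero_position a then None else Some (\<phi> (letter_content i a)))"
    using Cons.hyps(1) by (cases a) (auto simp: monoid_presentation_hom(1)[OF P] fun_eq_iff)
  have mult: "\<phi> (letter_content i a @ content i u) =
      \<phi> (letter_content i a) \<otimes>\<^bsub>M\<^esub> \<phi> (content i u)" for i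
    using letter_content_in_lists[OF Cons.hyps(1)] content_in_lists[OF Cons.hyps(2)]
    by (intro monoid_presentation_hom(3)[OF P]) auto
  have "word_image n M \<phi> (a # u) = letter_image n M \<phi> a \<otimes>\<^bsub>zero_power n M\<^esub> word_image n M \<phi> u"
    by (simp add: word_image_def)
  then show ?case
    unfolding Cons.IH letter
    by (auto simp: zero_power_def product_group_def adjoin_zero_def mult fun_eq_iff)
qed

lemma word_image_eq_iff:
  assumes P: "monoid_presentation M X R \<phi>"
    and u: "u \<in> lists (alphabet n X)" and v: "v \<in> lists (alphabet n X)"
  shows "word_image n M \<phi> u = word_image n M \<phi> v \<longleftrightarrow>
    zeros u = zeros v \<and> (\<forall>i\<in>{1..n} - zeros u. \<phi> (content i u) = \<phi> (content i v))"
    (is "?l = ?r")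
proof
  assume ?l
  then have *: "(if i \<in> zeros u then None else Some (\<phi> (content i u))) =
      (if i \<in> zeros v then None else Some (\<phi> (content i v)))" if "i \<in> {1..n}" for i
  proof -
    have "word_image n M \<phi> u i = word_image n M \<phi> v i" using \<open>?l\<close> by (rule fun_cong)
    then show ?thesis
      unfolding word_image_eq[OF P u] word_image_eq[OF P v] restrict_apply'[OF that] .
  qed
  have "i \<in> zeros u \<longleftrightarrow> i \<in> zeros v" if "i \<in> {1..n}" for i
    using *[OF that] by (simp split: if_splits)
  then have zeros: "zeros u = zeros v" using zeros_subset[OF u] zeros_subset[OF v] by blast
  show ?r
  proof (intro conjI zeros ballI)
    fix i assume "i \<in> {1..n} - zeros u"
    then show "\<phi> (content i u) = \<phi> (content i v)" using *[of i] zeros by simp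
  qed
next
  assume ?r
  then show ?l
    unfolding word_image_eq[OF P u] word_image_eq[OF P v] by (intro restrict_ext) auto
qed

lemma word_image_append:
  assumes P: "monoid_presentation M X R \<phi>"
    and u: "u \<in> lists (alphabet n X)" and v: "v \<in> lists (alphabet n X)"
  shows "word_image n M \<phi> (u @ v) = word_image n M \<phi> u \<otimes>\<^bsub>zero_power n M\<^esub> word_image n M \<phi> v"
proof -
  have "\<phi> (content i u @ content i v) = \<phi> (content i u) \<otimes>\<^bsub>M\<^esub> \<phi> (content i v)" for i
    by (intro monoid_presentation_hom(3)[OF P] content_in_lists[OF u] content_in_lists[OF v])
  moreover have "u @ v \<in> lists (alphabet n X)" using u v by simp
  ultimately show ?thesis
    unfolding word_image_eq[OF P u] word_image_eq[OF P v] word_image_eq[OF P \<open>u @ v \<in> _\<close>]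
    by (auto simp: zero_power_def product_group_def adjoin_zero_def fun_eq_iff)
qed

lemma relations_subset:
  assumes "R \<subseteq> lists X \<times> lists X"
  shows "relations n X R \<subseteq> carrier (free_semigroup (alphabet n X)) \<times> carrier (free_semigroup (alphabet n X))"
proof -
  have lift: "lift_word i j u \<in> lists (alphabet n X) - {[]}"
    if "u \<in> lists X" "i \<in> {1..n}" "j \<in> {1..n}" "i \<noteq> j" for i j u
    using lift_word_in_lists[OF that] by (auto simp: lift_word_def)
  have "p \<in> (lists (alphabet n X) - {[]}) \<times> (lists (alphabet n X) - {[]})"
    if "p \<in> relations n X R" for p
    using that unfolding relations_def
  proof (elim UnE)
    assume "p \<in> {(lift_word i j u, lift_word i j v) | i j u v.
        (u, v) \<in> R \<and> i \<in> {1..n} \<and> j \<in> {1..n} \<and> i \<noteq> j}"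
    then obtain i j u v where "p = (lift_word i j u, lift_word i j v)" "(u, v) \<in> R"
      "i \<in> {1..n}" "j \<in> {1..n}" "i \<noteq> j" by blast
    then show ?thesis using lift[of u i j] lift[of v i j] assms by blast
  qed auto
  then show ?thesis by (auto simp: free_semigroup_def)
qed

text \<open>
  Apart from the lifts of the pairs in \<open>R\<close>, the two sides of each relation have equal zeros and
  literally equal contents outside these zeros. A lifted pair has the common zero \<open>j\<close>, and only its
  contents at \<open>i\<close> differ.
\<close>

lemma relations_sound:
  assumes R: "\<And>u v. (u, v) \<in> R \<Longrightarrow> \<phi> u = \<phi> v" and uv: "(u, v) \<in> relations n X R"
  shows "zeros u = zeros v \<and> (\<forall>i\<in>{1..n} - zeros u. \<phi> (content i u) = \<phi> (content i v))"
  using uv unfolding relations_def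
proof (elim UnE)
  assume "(u, v) \<in> {(lift_word i j u, lift_word i j v) | i j u v.
      (u, v) \<in> R \<and> i \<in> {1..n} \<and> j \<in> {1..n} \<and> i \<noteq> j}"
  then obtain i j u' v' where "u = lift_word i j u'" "v = lift_word i j v'" "(u', v') \<in> R"
    by blast
  then show ?thesis using R by simp
qed auto

lemma carrier_Sing:
  "t \<in> carrier (Sing n M) \<longleftrightarrow>
    t \<in> extensional {1..n} \<and> (\<forall>i\<in>{1..n}. t i \<in> insert None (Some ` carrier M)) \<and>
    (\<exists>i\<in>{1..n}. t i = None)"
  by (auto simp: Sing_def zero_power_def product_group_def adjoin_zero_def PiE_def Pi_def)

lemma Sing_is_semigroup:
  assumes "monoid M" shows "is_semigroup (Sing n M)"
proof -
  interpret monoid M by fact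
  have mult: "s \<otimes>\<^bsub>Sing n M\<^esub> t =
      (\<lambda>i\<in>{1..n}. case (s i, t i) of (Some x, Some y) \<Rightarrow> Some (x \<otimes>\<^bsub>M\<^esub> y) | _ \<Rightarrow> None)" for s t
    by (simp add: Sing_def zero_power_def product_group_def adjoin_zero_def)
  show ?thesis
    unfolding is_semigroup_def
  proof (intro conjI ballI)
    fix s t assume s: "s \<in> carrier (Sing n M)" and t: "t \<in> carrier (Sing n M)"
    then obtain j where j: "j \<in> {1..n}" "s j = None" by (auto simp: carrier_Sing)
    have "(s \<otimes>\<^bsub>Sing n M\<^esub> t) i \<in> insert None (Some ` carrier M)" if "i \<in> {1..n}" for i
    proof -
      have "s i \<in> insert None (Some ` carrier M)" "t i \<in> insert None (Some ` carrier M)"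
        using s t that unfolding carrier_Sing by blast+
      then show ?thesis unfolding mult restrict_apply'[OF that] by (auto split: option.split)
    qed
    moreover have "(s \<otimes>\<^bsub>Sing n M\<^esub> t) j = None"
      unfolding mult restrict_apply'[OF j(1)] using j(2) by simp
    moreover have "s \<otimes>\<^bsub>Sing n M\<^esub> t \<in> extensional {1..n}"
      unfolding mult by (rule restrict_extensional)
    ultimately show "s \<otimes>\<^bsub>Sing n M\<^esub> t \<in> carrier (Sing n M)"
      unfolding carrier_Sing using j(1) by blast
  next
    fix r s t
    assume rst: "r \<in> carrier (Sing n M)" "s \<in> carrier (Sing n M)" "t \<in> carrier (Sing n M)"
    show "r \<otimes>\<^bsub>Sing n M\<^esub> s \<otimes>\<^bsub>Sing n M\<^esub> t = r \<otimes>\<^bsub>Sing n M\<^esub> (s \<otimes>\<^bsub>Sing n M\<^esub> t)"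
      unfolding mult
    proof (rule restrict_ext)
      fix i assume i: "i \<in> {1..n}"
      have "r i \<in> insert None (Some ` carrier M)" "s i \<in> insert None (Some ` carrier M)"
        "t i \<in> insert None (Some ` carrier M)"
        using rst i unfolding carrier_Sing by blast+
      then show "(case ((\<lambda>i\<in>{1..n}. case (r i, s i) of (Some x, Some y) \<Rightarrow> Some (x \<otimes>\<^bsub>M\<^esub> y) | _ \<Rightarrow> None) i, t i)
            of (Some x, Some y) \<Rightarrow> Some (x \<otimes>\<^bsub>M\<^esub> y) | _ \<Rightarrow> None) =
          (case (r i, (\<lambda>i\<in>{1..n}. case (s i, t i) of (Some x, Some y) \<Rightarrow> Some (x \<otimes>\<^bsub>M\<^esub> y) | _ \<Rightarrow> None) i)
            of (Some x, Some y) \<Rightarrow> Some (x \<otimes>\<^bsub>M\<^esub> y) | _ \<Rightarrow> None)"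
        unfolding restrict_apply'[OF i] by (auto simp: m_assoc split: option.split)
    qed
  qed
qed

lemma word_image_in_Sing:
  assumes P: "monoid_presentation M X R \<phi>"
    and u: "u \<in> lists (alphabet n X)" "u \<noteq> []"
  shows "word_image n M \<phi> u \<in> carrier (Sing n M)"
proof -
  have "\<phi> (content i u) \<in> carrier M" for i
    by (intro monoid_presentation_hom(2)[OF P] content_in_lists[OF u(1)])
  moreover have "\<exists>i\<in>{1..n}. i \<in> zeros u"
    using zeros_subset[OF u(1)] u(2) zeros_eq_empty[of u] by blast
  ultimately show ?thesis
    unfolding word_image_eq[OF P u(1)] carrier_Sing by auto
qed

text \<open>
  Any tuple with a zero at \<open>j\<close> is the value of the normal form with reference position \<open>j\<close> whose
  factors spell the non-zero entries.
\<close>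

lemma word_image_surj:
  assumes P: "monoid_presentation M X R \<phi>" and t: "t \<in> carrier (Sing n M)"
  shows "\<exists>u \<in> lists (alphabet n X) - {[]}. word_image n M \<phi> u = t"
proof -
  define Z where "Z = {i \<in> {1..n}. t i = None}"
  have "\<exists>j\<in>{1..n}. t j = None" using t unfolding carrier_Sing by (elim conjE)
  then obtain j where j: "j \<in> Z" unfolding Z_def by blast
  have Z: "Z \<subseteq> {1..n}" by (auto simp: Z_def)
  have onto: "\<phi> ` lists X = carrier M"
    using P by (simp add: monoid_presentation_def free_monoid_def)
  have "\<exists>v. v \<in> lists X \<and> t i = Some (\<phi> v)" if i: "i \<in> {1..n} - Z" for i
  proof -
    have "t i \<in> insert None (Some ` carrier M)" "t i \<noteq> None"
      using t i by (simp_all add: carrier_Sing Z_def)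
    then obtain a where a: "t i = Some a" "a \<in> carrier M" by blast
    from a(2) obtain v where "v \<in> lists X" "a = \<phi> v" unfolding onto[symmetric] by (rule imageE)
    with a(1) show ?thesis by (intro exI[of _ v] conjI) simp_all
  qed
  then have "\<forall>i \<in> {1..n} - Z. \<exists>v. v \<in> lists X \<and> t i = Some (\<phi> v)" by (rule ballI)
  from bchoice[OF this] obtain w where
    "\<forall>i \<in> {1..n} - Z. w i \<in> lists X \<and> t i = Some (\<phi> (w i))" by (rule exE)
  then have w: "w i \<in> lists X" "t i = Some (\<phi> (w i))" if "i \<in> {1..n} - Z" for i
    using that by (simp_all only: Ball_def)
  define u where "u = normal_form n j Z w"
  have u: "u \<in> lists (alphabet n X)"
    unfolding u_def by (rule normal_form_in_lists[OF subsetD[OF Z j] j w(1)])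
  have zeros: "zeros u = Z" unfolding u_def by (rule zeros_normal_form[OF j Z])
  have "word_image n M \<phi> u i = t i" for i
  proof (cases "i \<in> {1..n} - Z")
    case True
    then have "content i u = w i" unfolding u_def by (simp add: content_normal_form)
    then show ?thesis
      using True w(2)[OF True] unfolding word_image_eq[OF P u] zeros by simp
  next
    case False
    show ?thesis
    proof (cases "i \<in> {1..n}")
      case True
      with False have "i \<in> Z" "t i = None" by (simp_all add: Z_def)
      then show ?thesis unfolding word_image_eq[OF P u] zeros restrict_apply'[OF True] by simp
    next
      case False
      have "t \<in> extensional {1..n}" using t by (simp add: carrier_Sing)
      then have "t i = undefined" using False by (rule extensional_arb)
      then show ?thesis
        unfolding word_image_eq[OF P u] using False by (simp only: restrict_apply if_False)
    qed
  qed
  then have "word_image n M \<phi> u = t" by (rule ext)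
  moreover have "u \<noteq> []" using zeros j by auto
  ultimately show ?thesis using u by blast
qed

theorem theorem5p20:
  fixes M :: "('a, 'b) monoid_scheme"
    and X\<^sub>M :: "'x set"
    and R\<^sub>M :: "('x list \<times> 'x list) set"
    and \<phi>\<^sub>M :: "'x list \<Rightarrow> 'a"
    and n :: nat
  assumes "monoid M"
    and "monoid_presentation M X\<^sub>M R\<^sub>M \<phi>\<^sub>M"
    and "n \<ge> 2"
  shows "semigroup_presentation (Sing n M) (alphabet n X\<^sub>M) (relations n X\<^sub>M R\<^sub>M)
           (word_image n M \<phi>\<^sub>M)"
proof -
  note P = assms(2)
  let ?F = "free_semigroup (alphabet n X\<^sub>M)"
  let ?R = "relations n X\<^sub>M R\<^sub>M"
  let ?\<phi> = "word_image n M \<phi>\<^sub>M"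
  have F: "carrier ?F = lists (alphabet n X\<^sub>M) - {[]}" "u \<otimes>\<^bsub>?F\<^esub> v = u @ v" for u v
    by (auto simp: free_semigroup_def free_monoid_def)
  have R\<^sub>M: "R\<^sub>M \<subseteq> lists X\<^sub>M \<times> lists X\<^sub>M"
    and kernel: "kernel_pairs (free_monoid X\<^sub>M) \<phi>\<^sub>M = generated_congruence (free_monoid X\<^sub>M) R\<^sub>M"
    using P by (auto simp: monoid_presentation_def free_monoid_def)
  have sound: "\<phi>\<^sub>M u = \<phi>\<^sub>M v" if "(u, v) \<in> R\<^sub>M" for u v
  proof -
    have "(u, v) \<in> generated_congruence (free_monoid X\<^sub>M) R\<^sub>M"
      using that by (auto simp: generated_congruence_def)
    then show ?thesis using kernel by (auto simp: kernel_pairs_def)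
  qed
  note R = relations_subset[OF R\<^sub>M, of n]
  have hom: "?\<phi> (u @ v) = ?\<phi> u \<otimes>\<^bsub>Sing n M\<^esub> ?\<phi> v"
    if "u \<in> carrier ?F" "v \<in> carrier ?F" for u v
    using word_image_append[OF P, of u n v] that by (simp add: F Sing_def)
  have "kernel_pairs ?F ?\<phi> = generated_congruence ?F ?R"
  proof
    show "kernel_pairs ?F ?\<phi> \<subseteq> generated_congruence ?F ?R"
      unfolding generated_congruence_def
    proof (intro subsetI InterI, clarify)
      fix u v c
      assume uv: "(u, v) \<in> kernel_pairs ?F ?\<phi>" and c: "is_congruence ?F c" "?R \<subseteq> c"
      have u: "u \<in> lists (alphabet n X\<^sub>M)" "u \<noteq> []" and v: "v \<in> lists (alphabet n X\<^sub>M)"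
        and eq: "?\<phi> u = ?\<phi> v"
        using uv by (auto simp: kernel_pairs_def F)
      have "cong_closure ?R u v"
      proof (rule singular_relations.words_related[OF R\<^sub>M u v])
        show "zeros u = zeros v" using eq word_image_eq_iff[OF P u(1) v] by blast
        fix i assume "i \<in> {1..n} - zeros u"
        then have "\<phi>\<^sub>M (content i u) = \<phi>\<^sub>M (content i v)"
          using eq word_image_eq_iff[OF P u(1) v] by blast
        then show "(content i u, content i v) \<in> generated_congruence (free_monoid X\<^sub>M) R\<^sub>M"
          using content_in_lists[OF u(1)] content_in_lists[OF v]
          unfolding kernel[symmetric] by (simp add: kernel_pairs_def free_monoid_def)
      qed
      from cong_closure_in_congruence[OF this R c] show "(u, v) \<in> c" using u by blast
    qed
  next
    have "is_congruence ?F (kernel_pairs ?F ?\<phi>)"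
      unfolding is_congruence_def
    proof
      show "equiv (carrier ?F) (kernel_pairs ?F ?\<phi>)"
        by (rule equivI) (auto simp: kernel_pairs_def refl_on_def sym_def trans_def)
      show "\<forall>(u, v)\<in>kernel_pairs ?F ?\<phi>. \<forall>w\<in>carrier ?F.
          (w \<otimes>\<^bsub>?F\<^esub> u, w \<otimes>\<^bsub>?F\<^esub> v) \<in> kernel_pairs ?F ?\<phi> \<and>
          (u \<otimes>\<^bsub>?F\<^esub> w, v \<otimes>\<^bsub>?F\<^esub> w) \<in> kernel_pairs ?F ?\<phi>"
        using hom by (auto simp: kernel_pairs_def F)
    qed
    moreover have "?R \<subseteq> kernel_pairs ?F ?\<phi>"
    proof clarify
      fix u v assume uv: "(u, v) \<in> ?R"
      then have mem: "u \<in> carrier ?F" "v \<in> carrier ?F" using R by auto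
      then have "?\<phi> u = ?\<phi> v"
        using relations_sound[where \<phi>=\<phi>\<^sub>M, OF sound uv] word_image_eq_iff[OF P, of u n v] by (simp add: F)
      with mem show "(u, v) \<in> kernel_pairs ?F ?\<phi>" by (simp add: kernel_pairs_def)
    qed
    ultimately show "generated_congruence ?F ?R \<subseteq> kernel_pairs ?F ?\<phi>"
      by (auto simp: generated_congruence_def)
  qed
  moreover have "?\<phi> \<in> hom ?F (Sing n M)"
    using hom word_image_in_Sing[OF P] by (auto simp: hom_def F simp del: in_lists_conv_set)
  moreover have "?\<phi> ` carrier ?F = carrier (Sing n M)"
    using word_image_in_Sing[OF P] word_image_surj[OF P] unfolding F by blast
  ultimately show ?thesis
    using Sing_is_semigroup[OF assms(1)] R by (simp add: semigroup_presentation_def)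
qed

end
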